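(* Let $K_{n=1}^{\infty}a_n/1$ be a continued fraction with complex partial numerators $a_n$, and suppose that its odd and even parts converge to different values. Then $\lim_{n\to\infty}|a_n|=\infty$.
   Context: $K_{n=1}^{\infty} a_n/1$ denotes the continued fraction $\cfrac{a_1}{1+\cfrac{a_2}{1+\cfrac{a_3}{1+\cdots}}}$. Its $n$-th approximant is $A_n/B_n$, where $A_{-1}=1$, $A_0=0$, $B_{-1}=0$, $B_0=1$, and $A_n=A_{n-1}+a_nA_{n-2}$, $B_n=B_{n-1}+a_nB_{n-2}$ for $n\ge 1$. The even part is the continued fraction whose $n$-th numerator and denominator convergents are $A_{2n}$ and $B_{2n}$ ($n\ge 0$). The odd part is the continued fraction whose zeroth numerator and denominator convergents are $A_1/B_1$ and $1$, and whose $n$-th numerator and denominator convergents are $A_{2n+1}$ and $B_{2n+1}$ ($n\ge1$). Thus the even (respectively odd) part converges to a value when $A_{2n}/B_{2n}$ (respectively $A_{2n+1}/B_{2n+1}$) tends to that value as $n\to\infty$; here the values are elements of $\mathbb{C}$. *)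

theory Defs
  imports Complex_Main
begin

text \<open>
  The partial numerators of the continued fraction are \<open>a 1, a 2, \<dots>\<close>; the value \<open>a 0\<close> is
  never used.  The second equations below are the recurrence at \<open>n = 1\<close> with the initial
  values at index \<open>-1\<close> (\<open>1\<close> for numerators, \<open>0\<close> for denominators) already substituted.
\<close>

fun cf_num :: "(nat \<Rightarrow> complex) \<Rightarrow> nat \<Rightarrow> complex" where
  "cf_num a 0 = 0"
| "cf_num a (Suc 0) = cf_num a 0 + a 1 * 1"
| "cf_num a (Suc (Suc n)) = cf_num a (Suc n) + a (Suc (Suc n)) * cf_num a n"

fun cf_den :: "(nat \<Rightarrow> complex) \<Rightarrow> nat \<Rightarrow> complex" where
  "cf_den a 0 = 1"
| "cf_den a (Suc 0) = cf_den a 0 + a 1 * 0"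
| "cf_den a (Suc (Suc n)) = cf_den a (Suc n) + a (Suc (Suc n)) * cf_den a n"

definition even_part_num :: "(nat \<Rightarrow> complex) \<Rightarrow> nat \<Rightarrow> complex" where
  "even_part_num a n = cf_num a (2 * n)"

definition even_part_den :: "(nat \<Rightarrow> complex) \<Rightarrow> nat \<Rightarrow> complex" where
  "even_part_den a n = cf_den a (2 * n)"

definition odd_part_num :: "(nat \<Rightarrow> complex) \<Rightarrow> nat \<Rightarrow> complex" where
  "odd_part_num a n = (if n = 0 then cf_num a 1 / cf_den a 1 else cf_num a (2 * n + 1))"

definition odd_part_den :: "(nat \<Rightarrow> complex) \<Rightarrow> nat \<Rightarrow> complex" where
  "odd_part_den a n = (if n = 0 then 1 else cf_den a (2 * n + 1))"

text \<open>
  Since \<open>x / 0 = 0\<close> in HOL, convergence to a finite value has to require explicitly that only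
  finitely many approximants have a vanishing denominator.
\<close>

definition convergents_tend_to ::
    "(nat \<Rightarrow> complex) \<Rightarrow> (nat \<Rightarrow> complex) \<Rightarrow> complex \<Rightarrow> bool" where
  "convergents_tend_to P Q L \<longleftrightarrow>
     (\<forall>\<^sub>F n in sequentially. Q n \<noteq> 0) \<and> (\<lambda>n. P n / Q n) \<longlonglongrightarrow> L"

definition even_part_converges_to :: "(nat \<Rightarrow> complex) \<Rightarrow> complex \<Rightarrow> bool" where
  "even_part_converges_to a L \<longleftrightarrow> convergents_tend_to (even_part_num a) (even_part_den a) L"

definition odd_part_converges_to :: "(nat \<Rightarrow> complex) \<Rightarrow> complex \<Rightarrow> bool" where
  "odd_part_converges_to a L \<longleftrightarrow> convergents_tend_to (odd_part_num a) (odd_part_den a) L"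

end

theory Submission
  imports Defs
begin

text \<open>
  Write \<open>f n\<close> for the approximant \<open>A n / B n\<close> and \<open>h n\<close> for the quotient
  \<open>B (n - 1) / B n\<close> of consecutive denominators.  By the recurrence, both increments
  \<open>f (n + 2) - f n\<close> and \<open>f (n + 1) - f n\<close> are multiples of the same determinant, and their ratio
  is exactly \<open>h (n + 2)\<close> (lemma \<open>approximant_skip\<close>).  If the odd and even parts
  converge, the increments over two steps tend to \<open>0\<close>; if their limits differ, the increments over
  one step stay away from \<open>0\<close>.  Hence \<open>h\<close> tends to \<open>0\<close>.

  Dividing the recurrence for the denominators by \<open>B n\<close> gives
  \<open>1 = h n + a n * h n * h (n - 1)\<close>, so \<open>a n\<close> is a quotient whose numerator \<open>1 - h n\<close> tends
  to \<open>1\<close> and whose denominator tends to \<open>0\<close> (lemma \<open>partial_numerators_at_infinity\<close>).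
\<close>

lemma eventually_sequentially_even_odd:
  assumes "\<forall>\<^sub>F n in sequentially. P (2 * n)" and "\<forall>\<^sub>F n in sequentially. P (2 * n + 1)"
  shows "eventually P sequentially"
proof -
  obtain N N' where N: "\<And>n. n \<ge> N \<Longrightarrow> P (2 * n)" and N': "\<And>n. n \<ge> N' \<Longrightarrow> P (2 * n + 1)"
    using assms unfolding eventually_sequentially by blast
  have "P n" if "n \<ge> 2 * N + 2 * N' + 1" for n
  proof (cases "even n")
    case True
    then obtain m where "n = 2 * m" by (elim evenE)
    with that N show ?thesis by simp
  next
    case False
    then obtain m where "n = 2 * m + 1" by (elim oddE)
    with that N' show ?thesis by simp
  qed
  then show ?thesis unfolding eventually_sequentially by blast
qed

definition approximant :: "(nat \<Rightarrow> complex) \<Rightarrow> nat \<Rightarrow> complex" where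
  "approximant a n = cf_num a n / cf_den a n"

text \<open>Shifted by one to avoid an index \<open>- 1\<close>: \<open>den_ratio a n\<close> is the quotient \<open>h (n + 1)\<close>.\<close>

definition den_ratio :: "(nat \<Rightarrow> complex) \<Rightarrow> nat \<Rightarrow> complex" where
  "den_ratio a n = cf_den a n / cf_den a (Suc n)"

text \<open>
  In the cross difference of the convergents \<open>n + 2\<close> and \<open>n\<close> the terms containing the partial
  numerator cancel, which leaves the cross difference of the convergents \<open>n + 1\<close> and \<open>n\<close>.  The
  increments of the approximants are these equal quantities divided by \<open>B (n + 2) * B n\<close> and
  \<open>B (n + 1) * B n\<close>.
\<close>

lemma approximant_skip:
  assumes "cf_den a n \<noteq> 0" "cf_den a (Suc n) \<noteq> 0" "cf_den a (Suc (Suc n)) \<noteq> 0"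
  shows "approximant a (Suc (Suc n)) - approximant a n =
         (approximant a (Suc n) - approximant a n) * den_ratio a (Suc n)"
proof -
  have cross: "cf_num a (Suc (Suc n)) * cf_den a n - cf_num a n * cf_den a (Suc (Suc n)) =
               cf_num a (Suc n) * cf_den a n - cf_num a n * cf_den a (Suc n)"
    by (simp add: algebra_simps)
  have "approximant a (Suc (Suc n)) - approximant a n =
        (cf_num a (Suc (Suc n)) * cf_den a n - cf_num a n * cf_den a (Suc (Suc n)))
          / (cf_den a (Suc (Suc n)) * cf_den a n)"
    using assms by (simp add: approximant_def diff_frac_eq del: cf_num.simps cf_den.simps)
  also have "\<dots> = (approximant a (Suc n) - approximant a n) * den_ratio a (Suc n)"
    unfolding cross using assms
    by (simp add: approximant_def den_ratio_def diff_frac_eq del: cf_num.simps cf_den.simps)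
  finally show ?thesis .
qed

text \<open>
  The even and odd subsequences of the denominator ratios are both of this form: \<open>\<sigma>\<close> runs through
  the indices of one parity, \<open>x\<close> is the limit along \<open>\<sigma>\<close> and \<open>y\<close> the limit along the other parity.
\<close>

lemma den_ratio_subseq_tendsto_0:
  assumes den: "\<forall>\<^sub>F n in sequentially. cf_den a n \<noteq> 0"
    and \<sigma>: "filterlim \<sigma> sequentially sequentially"
    and x: "(\<lambda>n. approximant a (\<sigma> n)) \<longlonglongrightarrow> x"
    and x': "(\<lambda>n. approximant a (Suc (Suc (\<sigma> n)))) \<longlonglongrightarrow> x"
    and y: "(\<lambda>n. approximant a (Suc (\<sigma> n))) \<longlonglongrightarrow> y"
    and "x \<noteq> y"
  shows "(\<lambda>n. den_ratio a (Suc (\<sigma> n))) \<longlonglongrightarrow> 0"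
proof -
  define one where "one n = approximant a (Suc (\<sigma> n)) - approximant a (\<sigma> n)" for n
  define two where "two n = approximant a (Suc (Suc (\<sigma> n))) - approximant a (\<sigma> n)" for n
  have two: "two \<longlonglongrightarrow> 0"
    using tendsto_diff[OF x' x] by (simp add: two_def [abs_def])
  have one: "one \<longlonglongrightarrow> y - x"
    using tendsto_diff[OF y x] by (simp add: one_def [abs_def])
  have "y - x \<noteq> 0" using \<open>x \<noteq> y\<close> by simp
  then have "(\<lambda>n. two n / one n) \<longlonglongrightarrow> 0"
    using tendsto_divide[OF two one] by simp
  moreover have "\<forall>\<^sub>F n in sequentially. two n / one n = den_ratio a (Suc (\<sigma> n))"
  proof -
    have "\<forall>\<^sub>F n in sequentially. cf_den a (Suc n) \<noteq> 0"
      using den by (simp add: eventually_sequentially_Suc[of "\<lambda>n. cf_den a n \<noteq> 0"]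
          del: cf_den.simps)
    moreover from this have "\<forall>\<^sub>F n in sequentially. cf_den a (Suc (Suc n)) \<noteq> 0"
      by (simp add: eventually_sequentially_Suc[of "\<lambda>n. cf_den a (Suc n) \<noteq> 0"]
          del: cf_den.simps)
    ultimately have "\<forall>\<^sub>F n in sequentially.
        cf_den a n \<noteq> 0 \<and> cf_den a (Suc n) \<noteq> 0 \<and> cf_den a (Suc (Suc n)) \<noteq> 0"
      using den by (auto elim: eventually_elim2 simp: eventually_conj_iff simp del: cf_den.simps)
    from eventually_compose_filterlim[OF this \<sigma>]
      tendsto_imp_eventually_ne[OF one \<open>y - x \<noteq> 0\<close>]
    show ?thesis
      by eventually_elim (simp add: one_def two_def approximant_skip del: cf_den.simps)
  qed
  ultimately show ?thesis by (rule Lim_transform_eventually)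
qed

text \<open>
  Where no denominator vanishes, the recurrence expresses the partial numerator through the
  ratios alone.
\<close>

lemma partial_numerator_eq:
  assumes "cf_den a n \<noteq> 0" "cf_den a (Suc n) \<noteq> 0" "cf_den a (Suc (Suc n)) \<noteq> 0"
  shows "a (Suc (Suc n)) = (1 - den_ratio a (Suc n)) / (den_ratio a (Suc n) * den_ratio a n)"
proof -
  have "cf_den a (Suc (Suc n)) - cf_den a (Suc n) = a (Suc (Suc n)) * cf_den a n"
    by simp
  with assms show ?thesis
    by (simp add: den_ratio_def diff_divide_eq_iff divide_simps del: cf_den.simps)
qed

lemma partial_numerators_at_infinity:
  assumes den: "\<forall>\<^sub>F n in sequentially. cf_den a n \<noteq> 0"
    and ratio: "den_ratio a \<longlonglongrightarrow> 0"
  shows "filterlim a at_infinity sequentially"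
proof -
  have ratio': "(\<lambda>n. den_ratio a (Suc n)) \<longlonglongrightarrow> 0"
    using ratio by (simp only: filterlim_sequentially_Suc)
  have den1: "\<forall>\<^sub>F n in sequentially. cf_den a (Suc n) \<noteq> 0"
    using den by (simp add: eventually_sequentially_Suc[of "\<lambda>n. cf_den a n \<noteq> 0"]
        del: cf_den.simps)
  then have den2: "\<forall>\<^sub>F n in sequentially. cf_den a (Suc (Suc n)) \<noteq> 0"
    by (simp add: eventually_sequentially_Suc[of "\<lambda>n. cf_den a (Suc n) \<noteq> 0"]
        del: cf_den.simps)
  have "(\<lambda>n. 1 - den_ratio a (Suc n)) \<longlonglongrightarrow> 1"
    using tendsto_diff[OF tendsto_const ratio', of 1] by simp
  moreover have "filterlim (\<lambda>n. den_ratio a (Suc n) * den_ratio a n) (at 0) sequentially"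
  proof (rule filterlim_atI)
    show "(\<lambda>n. den_ratio a (Suc n) * den_ratio a n) \<longlonglongrightarrow> 0"
      using tendsto_mult[OF ratio' ratio] by simp
    show "\<forall>\<^sub>F n in sequentially. den_ratio a (Suc n) * den_ratio a n \<noteq> 0"
      using den den1 den2
      by eventually_elim (simp add: den_ratio_def del: cf_den.simps)
  qed
  ultimately have lim: "filterlim
      (\<lambda>n. (1 - den_ratio a (Suc n)) / (den_ratio a (Suc n) * den_ratio a n))
      at_infinity sequentially"
    unfolding divide_inverse
    by (intro tendsto_mult_filterlim_at_infinity[where c = 1]
        filterlim_compose[OF filterlim_inverse_at_infinity]) simp_all
  have eq: "\<forall>\<^sub>F n in sequentially. a (Suc (Suc n)) =
      (1 - den_ratio a (Suc n)) / (den_ratio a (Suc n) * den_ratio a n)"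
    using den den1 den2 by eventually_elim (rule partial_numerator_eq)
  have "filterlim (\<lambda>n. a (Suc (Suc n))) at_infinity sequentially"
    using lim filterlim_cong[OF refl refl eq] by blast
  then show ?thesis
    using filterlim_sequentially_Suc[of "\<lambda>n. a (Suc n)"] filterlim_sequentially_Suc[of a]
    by blast
qed

theorem theorem5:
  fixes a :: "nat \<Rightarrow> complex" and L M :: complex
  assumes "odd_part_converges_to a L"
    and "even_part_converges_to a M"
    and "L \<noteq> M"
  shows "filterlim (\<lambda>n. norm (a n)) at_top sequentially"
proof -
  have even_lim: "(\<lambda>n. approximant a (2 * n)) \<longlonglongrightarrow> M"
    and even_den: "\<forall>\<^sub>F n in sequentially. cf_den a (2 * n) \<noteq> 0"
    using assms(2)
    by (simp_all add: even_part_converges_to_def convergents_tend_to_def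
        even_part_num_def even_part_den_def approximant_def)
  \<comment> \<open>The normalised zeroth convergent of the odd part has the value of the first approximant, and
     its denominator is nonzero because the first denominator is \<open>1\<close>.\<close>
  have "odd_part_num a n / odd_part_den a n = approximant a (2 * n + 1)"
    and "odd_part_den a n \<noteq> 0 \<longleftrightarrow> cf_den a (2 * n + 1) \<noteq> 0" for n
    by (simp_all add: odd_part_num_def odd_part_den_def approximant_def)
  then have odd_lim: "(\<lambda>n. approximant a (2 * n + 1)) \<longlonglongrightarrow> L"
    and odd_den: "\<forall>\<^sub>F n in sequentially. cf_den a (2 * n + 1) \<noteq> 0"
    using assms(1) unfolding odd_part_converges_to_def convergents_tend_to_def by simp_all
  have even_lim': "(\<lambda>n. approximant a (2 * n + 2)) \<longlonglongrightarrow> M"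
    using LIMSEQ_Suc[OF even_lim] by simp
  have odd_lim': "(\<lambda>n. approximant a (2 * n + 3)) \<longlonglongrightarrow> L"
    using LIMSEQ_Suc[OF odd_lim] by (simp add: numeral_3_eq_3)

  have den: "\<forall>\<^sub>F n in sequentially. cf_den a n \<noteq> 0"
    using even_den odd_den by (rule eventually_sequentially_even_odd)
  have subseq: "filterlim (\<lambda>n::nat. 2 * n) sequentially sequentially"
    "filterlim (\<lambda>n::nat. 2 * n + 1) sequentially sequentially"
    by (simp_all add: filterlim_subseq strict_mono_def)
  have "(\<lambda>n. den_ratio a (Suc (2 * n))) \<longlonglongrightarrow> 0"
    using den_ratio_subseq_tendsto_0[OF den subseq(1) even_lim] even_lim' odd_lim \<open>L \<noteq> M\<close>
    by simp
  moreover have "(\<lambda>n. den_ratio a (Suc (2 * n + 1))) \<longlonglongrightarrow> 0"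
    using den_ratio_subseq_tendsto_0[OF den subseq(2) odd_lim] odd_lim' even_lim' \<open>L \<noteq> M\<close>
    by (simp add: numeral_3_eq_3)
  ultimately have "(\<lambda>n. den_ratio a (Suc n)) \<longlonglongrightarrow> 0"
    unfolding tendsto_def by (blast intro: eventually_sequentially_even_odd)
  then have "den_ratio a \<longlonglongrightarrow> 0"
    by (simp only: filterlim_sequentially_Suc)
  with den have "filterlim a at_infinity sequentially"
    by (rule partial_numerators_at_infinity)
  then show ?thesis
    by (rule filterlim_at_infinity_imp_norm_at_top)
qed

end
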